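(* Let $(J_n)_{n\ge0}$ be the Jacobsthal numbers, $J_0=0$, $J_1=1$, $J_n=J_{n-1}+2J_{n-2}$, and $(j_n)_{n\ge0}$ the Jacobsthal-Lucas numbers, $j_0=2$, $j_1=1$, $j_n=j_{n-1}+2j_{n-2}$. Then for all $n\ge1$, $$\sum_{i=1}^n i J_i = \frac{1}{2} \left( n J_{n+2} - \frac{J_{n+3}-3}{2} \right), \qquad \sum_{i=1}^n i j_i = \frac{1}{2} \left( n j_{n+2} - 4 - \frac{j_{n+3}-15}{2} \right).$$ *)

theory Defs imports Complex_Main begin

fun jacobsthal :: "nat \<Rightarrow> nat" where
  "jacobsthal 0 = 0"
| "jacobsthal (Suc 0) = 1"
| "jacobsthal (Suc (Suc n)) = jacobsthal (Suc n) + 2 * jacobsthal n"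

fun jacobsthal_lucas :: "nat \<Rightarrow> nat" where
  "jacobsthal_lucas 0 = 2"
| "jacobsthal_lucas (Suc 0) = 1"
| "jacobsthal_lucas (Suc (Suc n)) = jacobsthal_lucas (Suc n) + 2 * jacobsthal_lucas n"

end

theory Submission imports Defs begin

text \<open>Both identities depend only on the shared recurrence, so they are instances of
  \<open>sum_index_mult_recurrence\<close>; the initial values enter only through
  \<open>f 3\<close>. The recurrence gives \<open>f i = (f (i+2) - f (i+1)) / 2\<close>, and
  summation by parts does the rest.\<close>

text \<open>The term \<open>f 3\<close> makes both sides vanish at \<open>n = 0\<close>. In the
  step, \<open>f (n+4) - f (n+3) = 2 * f (n+2)\<close> reduces the increment of the right side to
  \<open>(n+1) * (f (n+3) - f (n+2)) / 2\<close>, which is \<open>(n+1) * f (n+1)\<close>.\<close>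

lemma sum_index_mult_recurrence:
  fixes f :: "nat \<Rightarrow> real"
  assumes "\<And>n. f (Suc (Suc n)) = f (Suc n) + 2 * f n"
  shows "(\<Sum>i=1..n. real i * f i) = 1 / 2 * (real n * f (n + 2) - (f (n + 3) - f 3) / 2)"
  by (induction n) (simp_all add: assms numeral_eq_Suc field_simps)

theorem theorem5p9:
  fixes n :: nat
  assumes "n \<ge> 1"
  shows "(\<Sum>i=1..n. real i * real (jacobsthal i))
           = 1 / 2 * (real n * real (jacobsthal (n + 2)) - (real (jacobsthal (n + 3)) - 3) / 2)
       \<and> (\<Sum>i=1..n. real i * real (jacobsthal_lucas i))
           = 1 / 2 * (real n * real (jacobsthal_lucas (n + 2)) - 4
                       - (real (jacobsthal_lucas (n + 3)) - 15) / 2)"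
proof
  have "jacobsthal 3 = 3"
    by (simp add: eval_nat_numeral)
  then show "(\<Sum>i=1..n. real i * real (jacobsthal i))
      = 1 / 2 * (real n * real (jacobsthal (n + 2)) - (real (jacobsthal (n + 3)) - 3) / 2)"
    using sum_index_mult_recurrence[of "\<lambda>i. real (jacobsthal i)" n] by simp
  \<comment> \<open>The constants -4 and 15 of the statement encode this value, since -4 + 15/2 =
    7/2.\<close>
  have "jacobsthal_lucas 3 = 7"
    by (simp add: eval_nat_numeral)
  then show "(\<Sum>i=1..n. real i * real (jacobsthal_lucas i))
      = 1 / 2 * (real n * real (jacobsthal_lucas (n + 2)) - 4
                  - (real (jacobsthal_lucas (n + 3)) - 15) / 2)"
    using sum_index_mult_recurrence[of "\<lambda>i. real (jacobsthal_lucas i)" n]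
    by (simp add: field_simps)
qed

end
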